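(* Consider a finite discounted MDP and its Q-value iteration $Q_{k+1}=F(Q_k)$. Let $\bar\rho$ be the joint spectral radius of the restricted family $\{\bar A_\pi:\pi\in\Theta\}$, and fix any $\varepsilon>0$ such that $\beta_\varepsilon:=\bar\rho+\varepsilon\in(0,1)$. Then there exists a constant $c_\varepsilon>0$, depending on $\varepsilon$ (and the MDP) but not on $Q_0$ or $k$, such that for every $Q_0\in\mathbb R^n$ the iterates satisfy $$\operatorname{dist}_2(Q_k,\mathcal X_1)\le c_\varepsilon\,\beta_\varepsilon^k\,\operatorname{dist}_2(Q_0,\mathcal X_1),\qquad \forall k\ge 0.$$
   Context: Finite discounted MDP: finite nonempty state set $\mathcal S$ and action set $\mathcal A$, transition probabilities $P(s'|s,a)$, expected one-step rewards $R(s,a)\in\mathbb R$, discount $\gamma\in(0,1)$. Put $n=|\mathcal S||\mathcal A|$ and identify functions $Q:\mathcal S\times\mathcal A\to\mathbb R$ with vectors in $\mathbb R^n$. $P$ also denotes the $n\times|\mathcal S|$ matrix with entry $P(s'|s,a)$ in row $(s,a)$, column $s'$. For a stochastic policy $\mu$ (a map $\mathcal S\to\Delta_{|\mathcal A|}$, the probability simplex over $\mathcal A$), $\Pi^\mu$ is the $|\mathcal S|\times n$ matrix with $(\Pi^\mu Q)(s)=\sum_a\mu(a|s)Q(s,a)$; a deterministic policy $\pi:\mathcal S\to\mathcal A$ is identified with its one-hot stochastic policy. $\Theta$ is the (finite) set of all deterministic policies. Bellman operator: $(FQ)(s,a)=R(s,a)+\gamma\sum_{s'}P(s'|s,a)\max_{a'}Q(s',a')$.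 $Q^*$ is the optimal Q-function, i.e. $Q^*(s,a)=\max_{\pi\in\Theta}Q^\pi(s,a)$, the unique fixed point of $F$. Q-value iteration: $Q_{k+1}=F(Q_k)$, $k\ge0$, with $Q_0\in\mathbb R^n$ arbitrary. $\mathbf 1\in\mathbb R^n$ is the all-ones vector, $\mathcal X_1:=Q^*+\operatorname{span}(\mathbf 1)$, $\operatorname{dist}_2$ is Euclidean distance to a set. $\mathbf\Pi_\perp:=I-\frac1n\mathbf 1\mathbf 1^\top$, $A_\pi:=\gamma P\Pi^\pi$, $\bar A_\pi:=\mathbf\Pi_\perp A_\pi\mathbf\Pi_\perp$. Joint spectral radius (JSR) of a finite set of square matrices $\{M_1,\dots,M_m\}$: $\rho(M_1,\dots,M_m)=\lim_{k\to\infty}\max_{(\sigma_1,\dots,\sigma_k)\in\{1,\dots,m\}^k}\|M_{\sigma_k}\cdots M_{\sigma_1}\|^{1/k}$ for any submultiplicative matrix norm (independent of the norm). *)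

theory Defs
  imports "HOL-Analysis.Analysis"
begin

text \<open>
  States and actions form finite types 's and 'a (nonempty, as all types are). A function on
  state-action pairs is a vector of type real^('s \<times> 'a), so that n = CARD('s \<times> 'a), and P is
  the matrix with entry P(s'|s,a) = P $ (s,a) $ s'. The norm on these vectors is the Euclidean one.
\<close>

definition transition_matrix :: "real^'s^('s::finite \<times> 'a::finite) \<Rightarrow> bool" where
  "transition_matrix P \<longleftrightarrow>
     (\<forall>s a s'. 0 \<le> P $ (s, a) $ s') \<and> (\<forall>s a. (\<Sum>s'\<in>UNIV. P $ (s, a) $ s') = 1)"

definition policy_matrix :: "('s::finite \<Rightarrow> 'a::finite \<Rightarrow> real) \<Rightarrow> real^('s \<times> 'a)^'s" where
  "policy_matrix \<mu> = (\<chi> s i. if fst i = s then \<mu> s (snd i) else 0)"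

lemma policy_matrix_mult:
  "(policy_matrix \<mu> *v Q) $ s = (\<Sum>a\<in>UNIV. \<mu> s a * Q $ (s, a))"
proof -
  have "(policy_matrix \<mu> *v Q) $ s
      = (\<Sum>(t, a)\<in>UNIV \<times> UNIV. (if t = s then \<mu> s a else 0) * Q $ (t, a))"
    by (simp add: policy_matrix_def matrix_vector_mult_def case_prod_beta UNIV_Times_UNIV)
  also have "\<dots> = (\<Sum>t\<in>UNIV. \<Sum>a\<in>UNIV. (if t = s then \<mu> s a else 0) * Q $ (t, a))"
    by (rule sum.cartesian_product[symmetric])
  also have "\<dots> = (\<Sum>t\<in>UNIV. if t = s then \<Sum>a\<in>UNIV. \<mu> s a * Q $ (s, a) else 0)"
    by (intro sum.cong) auto
  finally show ?thesis by simp
qed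

definition one_hot :: "('s \<Rightarrow> 'a) \<Rightarrow> 's \<Rightarrow> 'a \<Rightarrow> real" where
  "one_hot \<pi> s a = (if a = \<pi> s then 1 else 0)"

definition bellman ::
  "real^'s^('s::finite \<times> 'a::finite) \<Rightarrow> real^('s \<times> 'a) \<Rightarrow> real \<Rightarrow> real^('s \<times> 'a) \<Rightarrow> real^('s \<times> 'a)"
where
  "bellman P R \<gamma> Q =
     (\<chi> i. R $ i + \<gamma> * (\<Sum>s'\<in>UNIV. P $ i $ s' * Max (range (\<lambda>a'. Q $ (s', a')))))"

text \<open>
  The law, as a row vector, of the state-action pair at time t when the chain starts in the pair i
  and follows \<open>\<pi>\<close> from time 1 on.
\<close>

primrec pair_law ::
  "real^'s^('s::finite \<times> 'a::finite) \<Rightarrow> ('s \<Rightarrow> 'a) \<Rightarrow> 's \<times> 'a \<Rightarrow> nat \<Rightarrow> real^('s \<times> 'a)"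
where
  "pair_law P \<pi> i 0 = axis i 1"
| "pair_law P \<pi> i (Suc t) = pair_law P \<pi> i t v* (P ** policy_matrix (one_hot \<pi>))"

text \<open>
  The expected discounted return: pair_law P \<open>\<pi>\<close> i t \<open>\<bullet>\<close> R is the expected reward at time t.
\<close>

definition Q_policy ::
  "real^'s^('s::finite \<times> 'a::finite) \<Rightarrow> real^('s \<times> 'a) \<Rightarrow> real \<Rightarrow> ('s \<Rightarrow> 'a) \<Rightarrow> real^('s \<times> 'a)"
where
  "Q_policy P R \<gamma> \<pi> = (\<chi> i. \<Sum>t. \<gamma> ^ t * (pair_law P \<pi> i t \<bullet> R))"

definition Q_star ::
  "real^'s^('s::finite \<times> 'a::finite) \<Rightarrow> real^('s \<times> 'a) \<Rightarrow> real \<Rightarrow> real^('s \<times> 'a)"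
where
  "Q_star P R \<gamma> = (\<chi> i. Max (range (\<lambda>\<pi>. Q_policy P R \<gamma> \<pi> $ i)))"

definition X1 ::
  "real^'s^('s::finite \<times> 'a::finite) \<Rightarrow> real^('s \<times> 'a) \<Rightarrow> real \<Rightarrow> (real^('s \<times> 'a)) set"
where
  "X1 P R \<gamma> = (\<lambda>v. Q_star P R \<gamma> + v) ` span {vec 1}"

definition proj_perp :: "real^'n^'n" where
  "proj_perp = mat 1 - (1 / real CARD('n)) *\<^sub>R (\<chi> i j. 1)"

definition A_mat ::
  "real^'s^('s::finite \<times> 'a::finite) \<Rightarrow> real \<Rightarrow> ('s \<Rightarrow> 'a) \<Rightarrow> real^('s \<times> 'a)^('s \<times> 'a)"
where
  "A_mat P \<gamma> \<pi> = \<gamma> *\<^sub>R (P ** policy_matrix (one_hot \<pi>))"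

definition A_bar ::
  "real^'s^('s::finite \<times> 'a::finite) \<Rightarrow> real \<Rightarrow> ('s \<Rightarrow> 'a) \<Rightarrow> real^('s \<times> 'a)^('s \<times> 'a)"
where
  "A_bar P \<gamma> \<pi> = proj_perp ** A_mat P \<gamma> \<pi> ** proj_perp"

text \<open>
  The product of the list \<open>[M\<^sub>1, \<dots>, M\<^sub>k]\<close> is \<open>M\<^sub>k ** \<dots> ** M\<^sub>1\<close>. (The type class multiplication on
  real^'n^'n is entrywise, so prod_list does not apply.)
\<close>

definition matrix_list_prod :: "(real^'n^'n) list \<Rightarrow> real^'n^'n" where
  "matrix_list_prod Ms = fold (**) Ms (mat 1)"

text \<open>
  The joint spectral radius of a finite nonempty set of matrices. It does not depend on the choice
  of the submultiplicative matrix norm; here it is the operator norm induced by the Euclidean norm.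
\<close>

definition joint_spectral_radius :: "(real^'n^'n) set \<Rightarrow> real" where
  "joint_spectral_radius \<M> =
     lim (\<lambda>k. Max ((\<lambda>Ms. root k (onorm ((*v) (matrix_list_prod Ms))))
                     ` {Ms. length Ms = k \<and> set Ms \<subseteq> \<M>}))"

end

theory Submission
  imports Defs
begin

text \<open>
  State by state, the difference of the maxima of two Q-functions lies between two entries of the
  difference of the Q-functions. Hence one Bellman step maps the error \<open>Q - Q\<^sup>*\<close> into the convex
  hull of its images under the matrices \<open>A\<^sub>\<pi>\<close>. Since \<open>A\<^sub>\<pi>\<close> preserves the span of the ones vector,
  the projected error after k steps lies in the convex hull of the images of the initial projected
  error under products of k projected matrices, whose norms the joint spectral radius controls.
  The distance to X1 is the norm of the projected error.
\<close>

lemma Max_image_attained: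
  assumes "finite A" and "A \<noteq> {}"
  obtains x where "x \<in> A" and "Max (f ` A) = f x"
proof -
  have "Max (f ` A) \<in> f ` A" using assms by (intro Max_in) auto
  then show ?thesis by (rule imageE) (use that in blast)
qed

section \<open>The joint spectral radius\<close>

text \<open>Fekete's lemma in multiplicative form: the sequence tends to its infimum over positive indices.\<close>

lemma convergent_root_submultiplicative:
  fixes a :: "nat \<Rightarrow> real"
  assumes nonneg: "\<And>k. 0 \<le> a k" and submult: "\<And>m n. a (m + n) \<le> a m * a n"
  shows "convergent (\<lambda>k. root k (a k))"
proof -
  define L where "L = (INF k\<in>{1..}. root k (a k))"
  have bdd: "bdd_below ((\<lambda>k. root k (a k)) ` {1..})"
    by (rule bdd_belowI[of _ 0]) (auto simp: nonneg)
  have lower: "L \<le> root n (a n)" if "n \<ge> 1" for n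
    unfolding L_def using that bdd by (intro cINF_lower) auto
  have L0: "0 \<le> L"
    unfolding L_def by (rule cINF_greatest) (auto simp: nonneg)
  have upper: "eventually (\<lambda>n. root n (a n) < r) sequentially" if r: "L < r" for r
  proof -
    \<comment> \<open>The gap between \<open>r'\<close> and \<open>r\<close> later absorbs the
      factor \<open>root n D\<close>, which tends to 1.\<close>
    obtain r' where r': "L < r'" "r' < r" using r dense by blast
    have r'0: "0 < r'" using L0 r' by linarith
    have "\<exists>m\<in>{1..}. root m (a m) < r'"
      using r'(1) bdd unfolding L_def by (subst (asm) cINF_less_iff) auto
    then obtain m where m: "m \<ge> 1" "root m (a m) < r'" by auto
    have am: "a m \<le> r' ^ m"
    proof -
      have "a m = root m (a m) ^ m" using m nonneg by simp
      also have "\<dots> \<le> r' ^ m" using m nonneg by (intro power_mono) auto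
      finally show ?thesis .
    qed
    \<comment> \<open>The sum dominates every remainder term \<open>a s / r' ^ s\<close> with
      \<open>s < m\<close>; the added 1 keeps \<open>D\<close> positive even if all of them vanish,
      so that \<open>root n D\<close> tends to 1.\<close>
    define D where "D = 1 + (\<Sum>s<m. a s / r' ^ s)"
    have D: "0 < D" unfolding D_def using nonneg r'0
      by (intro add_pos_nonneg sum_nonneg) auto
    have small: "a s \<le> D * r' ^ s" if "s < m" for s
    proof -
      have "a s / r' ^ s \<le> (\<Sum>s<m. a s / r' ^ s)"
        using that nonneg r'0 by (intro member_le_sum) auto
      then have "a s / r' ^ s \<le> D" by (simp add: D_def)
      then show ?thesis using r'0 by (simp add: divide_simps)
    qed
    \<comment> \<open>Division with remainder by \<open>m\<close>: each of the \<open>q\<close> full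
      blocks costs at most \<open>r' ^ m\<close>, and the remainder is covered by
      \<open>D\<close>.\<close>
    have step: "a (q * m + s) \<le> D * r' ^ (q * m + s)" if "s < m" for q s
    proof (induction q)
      case 0
      then show ?case using small[OF that] by simp
    next
      case (Suc q)
      have "a (Suc q * m + s) \<le> a m * a (q * m + s)"
        using submult[of m "q * m + s"] by (simp add: add.assoc)
      also have "\<dots> \<le> r' ^ m * (D * r' ^ (q * m + s))"
        using am Suc nonneg r'0 by (intro mult_mono) auto
      finally show ?case by (simp add: power_add algebra_simps)
    qed
    have bound: "a n \<le> D * r' ^ n" for n
      using step[of "n mod m" "n div m"] m by simp
    have root_bound: "root n (a n) \<le> root n D * r'" if "n \<ge> 1" for n
    proof -
      have "root n (a n) \<le> root n (D * r' ^ n)" using that bound by simp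
      also have "\<dots> = root n D * r'"
        using that r'0 by (simp add: real_root_mult real_root_power_cancel)
      finally show ?thesis .
    qed
    have "(\<lambda>n. root n D * r') \<longlonglongrightarrow> 1 * r'"
      using D by (intro tendsto_mult LIMSEQ_root_const tendsto_const)
    then have "eventually (\<lambda>n. root n D * r' < r) sequentially"
      using r' by (intro order_tendstoD(2)) auto
    then show ?thesis
      using eventually_ge_at_top[of 1] by eventually_elim (use root_bound in force)
  qed
  have "(\<lambda>k. root k (a k)) \<longlonglongrightarrow> L"
  proof (rule order_tendstoI)
    fix l assume l: "l < L"
    show "eventually (\<lambda>n. l < root n (a n)) sequentially"
      using eventually_ge_at_top[of 1] by eventually_elim (use lower l in force)
  qed (rule upper)
  then show ?thesis by (auto simp: convergent_def)
qed

section \<open>Growth of products of matrices from a finite family\<close>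

lemma fold_matrix_mult: "fold (**) Ms X = matrix_list_prod Ms ** (X :: real^'n^'n)"
proof (induction Ms arbitrary: X)
  case (Cons M Ms)
  show ?case
    using Cons[of "M ** X"] Cons[of M] by (simp add: matrix_list_prod_def matrix_mul_assoc)
qed (simp add: matrix_list_prod_def)

lemma matrix_list_prod_append:
  "matrix_list_prod (Ms @ Ns) = matrix_list_prod Ns ** matrix_list_prod Ms"
  by (metis fold_append comp_apply fold_matrix_mult matrix_list_prod_def)

lemma matrix_list_prod_snoc: "matrix_list_prod (Ms @ [M]) = M ** matrix_list_prod Ms"
  by (simp add: matrix_list_prod_def)

text \<open>Only finitely many lengths can violate the rate \<open>\<beta>\<close>, because the
  roots of the maximal norms converge to a limit below it; the constant absorbs these
  lengths.\<close>

lemma joint_spectral_radius_bound: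
  fixes \<M> :: "(real^'n^'n) set"
  assumes fin: "finite \<M>" and ne: "\<M> \<noteq> {}"
    and less: "joint_spectral_radius \<M> < \<beta>" and pos: "0 < \<beta>"
  obtains c where "0 < c"
    and "\<And>Ms. set Ms \<subseteq> \<M> \<Longrightarrow> onorm ((*v) (matrix_list_prod Ms)) \<le> c * \<beta> ^ length Ms"
proof -
  define W where "W k = {Ms. length Ms = k \<and> set Ms \<subseteq> \<M>}" for k
  define nrm where "nrm Ms = onorm ((*v) (matrix_list_prod Ms))" for Ms :: "(real^'n^'n) list"
  define a where "a k = Max (nrm ` W k)" for k
  have finW: "finite (W k)" for k
    using finite_lists_length_eq[OF fin, of k] by (simp add: W_def conj_commute)
  obtain M where M: "M \<in> \<M>" using ne by auto
  have neW: "W k \<noteq> {}" for k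
  proof -
    have "replicate k M \<in> W k" using M by (auto simp: W_def)
    then show ?thesis by auto
  qed
  have nrm0: "0 \<le> nrm Ms" for Ms unfolding nrm_def by (intro onorm_pos_le) auto
  have le_a: "nrm Ms \<le> a (length Ms)" if "set Ms \<subseteq> \<M>" for Ms
    unfolding a_def using finW that by (intro Max_ge) (auto simp: W_def)
  have a_attained: "\<exists>Ms\<in>W k. a k = nrm Ms" for k
    unfolding a_def by (rule Max_image_attained[OF finW[of k] neW[of k], of nrm]) blast
  have a0: "0 \<le> a k" for k using a_attained[of k] nrm0 by auto
  have "a (m + n) \<le> a m * a n" for m n
  proof -
    \<comment> \<open>A word of maximal norm is cut after \<open>m\<close> letters; the operator
      norm of the product is at most the product of the norms of the two pieces.\<close>
    obtain Ms where Ms: "Ms \<in> W (m + n)" "a (m + n) = nrm Ms" using a_attained by blast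
    define Xs Ys where "Xs = take m Ms" and "Ys = drop m Ms"
    have Ms_eq: "Ms = Xs @ Ys" by (simp add: Xs_def Ys_def)
    have len: "length Xs = m" "length Ys = n" using Ms by (auto simp: W_def Xs_def Ys_def)
    have sub: "set Xs \<subseteq> \<M>" "set Ys \<subseteq> \<M>" using Ms Ms_eq by (auto simp: W_def)
    have "(*v) (matrix_list_prod Ms) = (*v) (matrix_list_prod Ys) \<circ> (*v) (matrix_list_prod Xs)"
      by (simp add: Ms_eq matrix_list_prod_append fun_eq_iff matrix_vector_mul_assoc)
    then have "nrm Ms \<le> nrm Ys * nrm Xs"
      unfolding nrm_def by (simp add: onorm_compose)
    also have "\<dots> \<le> a n * a m"
      using le_a[OF sub(1)] le_a[OF sub(2)] len nrm0 a0 by (intro mult_mono) auto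
    finally show ?thesis using Ms by (simp add: mult.commute)
  qed
  \<comment> \<open>Convergence comes first, since \<open>lim\<close> in the definition of the joint
    spectral radius carries information only for a convergent sequence.\<close>
  then have "convergent (\<lambda>k. root k (a k))"
    using a0 by (rule convergent_root_submultiplicative[rotated])
  moreover have "(\<lambda>k. root k (a k))
      = (\<lambda>k. Max ((\<lambda>Ms. root k (nrm Ms)) ` {Ms. length Ms = k \<and> set Ms \<subseteq> \<M>}))"
  proof
    fix k
    \<comment> \<open>Monotonicity moves the root inside the maximum. The case \<open>k = 0\<close>
      is covered too, as \<open>root 0\<close> is constantly 0.\<close>
    have "mono (root k)"
      by (cases "k = 0") (auto simp: mono_def)
    then have "root k (a k) = Max (root k ` nrm ` W k)"
      unfolding a_def using finW neW by (intro mono_Max_commute) auto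
    then show "root k (a k) = Max ((\<lambda>Ms. root k (nrm Ms)) ` {Ms. length Ms = k \<and> set Ms \<subseteq> \<M>})"
      by (simp add: image_image W_def)
  qed
  then have "lim (\<lambda>k. root k (a k)) = joint_spectral_radius \<M>"
    by (simp add: joint_spectral_radius_def nrm_def)
  ultimately have "(\<lambda>k. root k (a k)) \<longlonglongrightarrow> joint_spectral_radius \<M>"
    by (simp add: convergent_LIMSEQ_iff)
  then have "eventually (\<lambda>k. root k (a k) < \<beta>) sequentially"
    using less by (rule order_tendstoD(2))
  then obtain N where N: "\<And>k. k \<ge> N \<Longrightarrow> root k (a k) < \<beta>"
    by (auto simp: eventually_sequentially)
  \<comment> \<open>The sum runs up to and including \<open>N\<close>, so every remaining length is
    positive and \<open>root k (a k) ^ k\<close> recovers \<open>a k\<close>. The summand 1 makes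
    \<open>c\<close> large enough for those lengths.\<close>
  define c where "c = 1 + (\<Sum>k<Suc N. a k / \<beta> ^ k)"
  have sum0: "0 \<le> (\<Sum>k<Suc N. a k / \<beta> ^ k)" using a0 pos by (intro sum_nonneg) auto
  have "a k \<le> c * \<beta> ^ k" for k
  proof (cases "k < Suc N")
    case True
    have "a k / \<beta> ^ k \<le> (\<Sum>k<Suc N. a k / \<beta> ^ k)"
      using True a0 pos by (intro member_le_sum) auto
    then have "a k / \<beta> ^ k \<le> c" by (simp add: c_def)
    then show ?thesis using pos by (simp add: divide_simps)
  next
    case False
    then have "a k = root k (a k) ^ k" using a0 by simp
    also have "\<dots> \<le> \<beta> ^ k" using N[of k] False a0 by (intro power_mono) auto
    also have "\<dots> \<le> c * \<beta> ^ k" using sum0 pos by (simp add: c_def)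
    finally show ?thesis .
  qed
  moreover have "0 < c" using sum0 by (simp add: c_def)
  ultimately show ?thesis
    using that le_a by (metis nrm_def order_trans)
qed

section \<open>The optimal Q-function is a fixed point of the Bellman operator\<close>

abbreviation pair_matrix ::
  "real^'s^('s::finite \<times> 'a::finite) \<Rightarrow> ('s \<Rightarrow> 'a) \<Rightarrow> real^('s \<times> 'a)^('s \<times> 'a)" where
  "pair_matrix P \<pi> \<equiv> P ** policy_matrix (one_hot \<pi>)"

lemma policy_matrix_one_hot_mult: "(policy_matrix (one_hot \<pi>) *v Q) $ s = Q $ (s, \<pi> s)"
  by (simp add: policy_matrix_mult one_hot_def if_distrib[of "\<lambda>x. x * _"] cong: if_cong)

lemma pair_matrix_mult:
  "(pair_matrix P \<pi> *v Q) $ i = (\<Sum>s\<in>UNIV. P $ i $ s * Q $ (s, \<pi> s))"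
  unfolding matrix_vector_mul_assoc[symmetric]
  by (subst matrix_vector_mult_def) (simp add: policy_matrix_one_hot_mult)

lemma A_mat_mult:
  "(A_mat P \<gamma> \<pi> *v Q) $ i = \<gamma> * (\<Sum>s\<in>UNIV. P $ i $ s * Q $ (s, \<pi> s))"
  by (simp add: A_mat_def scaleR_matrix_vector_assoc[symmetric] pair_matrix_mult)

text \<open>Each step of the law moves across the inner product as a matrix acting on
  \<open>x\<close>, which is why \<open>x\<close> varies in the induction. Expected rewards thus
  become iterates of one linear map.\<close>

lemma pair_law_inner: "pair_law P \<pi> i t \<bullet> x = (((*v) (pair_matrix P \<pi>) ^^ t) x) $ i"
proof (induction t arbitrary: x)
  case 0
  then show ?case by (simp add: inner_axis')
next
  case (Suc t)
  then show ?case by (simp add: dot_lmul_matrix funpow_swap1)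
qed

lemma transition_weighted_sum_le:
  assumes "transition_matrix P" and "\<And>s. x s \<le> b"
  shows "(\<Sum>s\<in>UNIV. P $ i $ s * x s) \<le> b"
proof -
  obtain s a where i: "i = (s, a)" by (cases i)
  have "(\<Sum>s\<in>UNIV. P $ i $ s * x s) \<le> (\<Sum>s\<in>UNIV. P $ i $ s * b)"
    using assms by (intro sum_mono mult_left_mono) (auto simp: transition_matrix_def i)
  also have "\<dots> = b"
    using assms(1) by (simp add: sum_distrib_right[symmetric] transition_matrix_def i)
  finally show ?thesis .
qed

lemma transition_nonneg: "transition_matrix P \<Longrightarrow> 0 \<le> P $ i $ s"
  by (cases i) (auto simp: transition_matrix_def)

text \<open>Splitting off the reward at time 0 leaves the discounted series shifted by one step. The
  series converges by comparison with a geometric one, since averaging never raises the largest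
  absolute reward.\<close>

lemma Q_policy_fixed_point:
  assumes P: "transition_matrix P" and \<gamma>: "0 < \<gamma>" "\<gamma> < 1"
  shows "Q_policy P R \<gamma> \<pi> = R + A_mat P \<gamma> \<pi> *v Q_policy P R \<gamma> \<pi>"
proof -
  define v where "v t = ((*v) (pair_matrix P \<pi>) ^^ t) R" for t
  define C where "C = Max (range (\<lambda>i. \<bar>R $ i\<bar>))"
  have bound: "\<bar>v t $ i\<bar> \<le> C" for t i
  proof (induction t arbitrary: i)
    case 0
    then show ?case by (simp add: v_def C_def)
  next
    case (Suc t)
    have "\<bar>v (Suc t) $ i\<bar> \<le> (\<Sum>s\<in>UNIV. \<bar>P $ i $ s * v t $ (s, \<pi> s)\<bar>)"
      by (simp add: v_def pair_matrix_mult)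
    also have "\<dots> = (\<Sum>s\<in>UNIV. P $ i $ s * \<bar>v t $ (s, \<pi> s)\<bar>)"
      by (simp add: abs_mult transition_nonneg[OF P])
    also have "\<dots> \<le> C" using P Suc by (rule transition_weighted_sum_le)
    finally show ?case .
  qed
  have summable: "summable (\<lambda>t. \<gamma> ^ t * v t $ i)" for i
  proof (rule summable_comparison_test')
    show "summable (\<lambda>t. C * \<gamma> ^ t)" using \<gamma> by (intro summable_mult summable_geometric) auto
    show "norm (\<gamma> ^ t * v t $ i) \<le> C * \<gamma> ^ t" for t
      using bound \<gamma> by (simp add: abs_mult mult.commute mult_right_mono)
  qed
  have Q: "Q_policy P R \<gamma> \<pi> $ i = (\<Sum>t. \<gamma> ^ t * v t $ i)" for i
    by (simp add: Q_policy_def pair_law_inner v_def)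
  have "Q_policy P R \<gamma> \<pi> $ i = (R + A_mat P \<gamma> \<pi> *v Q_policy P R \<gamma> \<pi>) $ i" for i
  proof -
    have sums: "(\<lambda>t. \<gamma> ^ t * v t $ j) sums (Q_policy P R \<gamma> \<pi> $ j)" for j
      using summable Q by (simp add: summable_sums)
    have "(\<lambda>t. \<gamma> * (\<Sum>s\<in>UNIV. P $ i $ s * (\<gamma> ^ t * v t $ (s, \<pi> s))))
        sums (A_mat P \<gamma> \<pi> *v Q_policy P R \<gamma> \<pi>) $ i"
      unfolding A_mat_mult by (intro sums_mult sums_sum sums)
    moreover have "\<gamma> * (\<Sum>s\<in>UNIV. P $ i $ s * (\<gamma> ^ t * v t $ (s, \<pi> s)))
        = \<gamma> ^ Suc t * v (Suc t) $ i" for t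
      by (simp add: v_def pair_matrix_mult sum_distrib_left mult_ac)
    ultimately have "(\<lambda>t. \<gamma> ^ Suc t * v (Suc t) $ i) sums (A_mat P \<gamma> \<pi> *v Q_policy P R \<gamma> \<pi>) $ i"
      by simp
    \<comment> \<open>The term at time 0, equal to \<open>R $ i\<close>, is put back in front of the
      shifted series.\<close>
    then have "(\<lambda>t. \<gamma> ^ t * v t $ i) sums
        ((A_mat P \<gamma> \<pi> *v Q_policy P R \<gamma> \<pi>) $ i + \<gamma> ^ 0 * v 0 $ i)"
      by (rule sums_Suc)
    then show ?thesis using sums[of i] sums_unique2 by (fastforce simp: v_def)
  qed
  then show ?thesis by (simp add: vec_eq_iff)
qed

text \<open>Maximum principle: at an index where \<open>d\<close> attains its maximum
  \<open>m\<close>, averaging and discounting give \<open>m \<le> \<gamma> * m\<close>, hence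
  \<open>m \<le> 0\<close>.\<close>

lemma nonpos_if_le_A_mat:
  assumes P: "transition_matrix P" and \<gamma>: "0 < \<gamma>" "\<gamma> < 1"
    and le: "\<And>i. d $ i \<le> (A_mat P \<gamma> \<pi> *v d) $ i"
  shows "d $ i \<le> 0"
proof -
  define m where "m = Max (range (\<lambda>i. d $ i))"
  have le_m: "d $ j \<le> m" for j by (simp add: m_def)
  obtain j where j: "m = d $ j"
    unfolding m_def by (rule Max_image_attained[of UNIV "\<lambda>i. d $ i"]) auto
  have "m \<le> \<gamma> * (\<Sum>s\<in>UNIV. P $ j $ s * d $ (s, \<pi> s))"
    using le[of j] j by (simp add: A_mat_mult)
  also have "\<dots> \<le> \<gamma> * m"
    using \<gamma> P le_m by (intro mult_left_mono transition_weighted_sum_le) auto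
  finally have "m * (1 - \<gamma>) \<le> 0" by (simp add: algebra_simps)
  then have "m \<le> 0" using \<gamma> by (simp add: mult_le_0_iff)
  then show ?thesis using le_m[of i] by simp
qed

text \<open>Subtracting the fixed point equation cancels \<open>R\<close>, so the maximum principle
  applies to the difference. This yields policy improvement.\<close>

lemma le_Q_policy:
  assumes P: "transition_matrix P" and \<gamma>: "0 < \<gamma>" "\<gamma> < 1"
    and le: "\<And>i. x $ i \<le> (R + A_mat P \<gamma> \<pi> *v x) $ i"
  shows "x $ i \<le> Q_policy P R \<gamma> \<pi> $ i"
proof -
  let ?Q = "Q_policy P R \<gamma> \<pi>"
  have "(x - ?Q) $ j \<le> (A_mat P \<gamma> \<pi> *v (x - ?Q)) $ j" for j
    using le[of j] arg_cong[OF Q_policy_fixed_point[OF P \<gamma>, of R \<pi>], of "\<lambda>v. v $ j"]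
    by (simp add: matrix_vector_mult_diff_distrib)
  from nonpos_if_le_A_mat[OF P \<gamma> this, of i] show ?thesis by simp
qed

text \<open>The same comparison with the sign reversed; it later bounds the values of all policies
  by one fixed point of the Bellman operator.\<close>

lemma Q_policy_le:
  assumes P: "transition_matrix P" and \<gamma>: "0 < \<gamma>" "\<gamma> < 1"
    and le: "\<And>i. (R + A_mat P \<gamma> \<pi> *v x) $ i \<le> x $ i"
  shows "Q_policy P R \<gamma> \<pi> $ i \<le> x $ i"
proof -
  let ?Q = "Q_policy P R \<gamma> \<pi>"
  have "(?Q - x) $ j \<le> (A_mat P \<gamma> \<pi> *v (?Q - x)) $ j" for j
    using le[of j] arg_cong[OF Q_policy_fixed_point[OF P \<gamma>, of R \<pi>], of "\<lambda>v. v $ j"]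
    by (simp add: matrix_vector_mult_diff_distrib)
  from nonpos_if_le_A_mat[OF P \<gamma> this, of i] show ?thesis by simp
qed

section \<open>Greedy policies and optimality\<close>

lemma policy_le_bellman:
  assumes P: "transition_matrix P" and \<gamma>: "0 < \<gamma>"
  shows "(R + A_mat P \<gamma> \<pi> *v Q) $ i \<le> bellman P R \<gamma> Q $ i"
  using \<gamma> by (auto simp: bellman_def A_mat_mult
      intro!: mult_left_mono sum_mono transition_nonneg[OF P])

lemma greedy_policy:
  obtains \<pi> where "\<And>s. Q $ (s, \<pi> s) = Max (range (\<lambda>a. Q $ (s, a :: 'a::finite)))"
proof -
  have "\<exists>a. Q $ (s, a) = Max (range (\<lambda>a. Q $ (s, a)))" for s
    by (rule Max_image_attained[of UNIV "\<lambda>a. Q $ (s, a)"]) (auto intro: exI sym)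
  then show ?thesis using that by metis
qed

lemma bellman_greedy:
  assumes "\<And>s. Q $ (s, \<pi> s) = Max (range (\<lambda>a. Q $ (s, a)))"
  shows "bellman P R \<gamma> Q = R + A_mat P \<gamma> \<pi> *v Q"
  by (simp add: vec_eq_iff bellman_def A_mat_mult assms)

text \<open>
  A policy with the largest sum of values cannot be improved by acting greedily with respect to
  its own Q-function, which is therefore a fixed point.
\<close>

lemma bellman_Q_star:
  assumes P: "transition_matrix P" and \<gamma>: "0 < \<gamma>" "\<gamma> < 1"
  shows "bellman P R \<gamma> (Q_star P R \<gamma>) = Q_star P R \<gamma>"
proof -
  \<comment> \<open>Entrywise comparison of policies is only a partial order; the sum of the entries
    surely has a maximizer among the finitely many policies.\<close>
  define total where "total \<pi> = (\<Sum>i\<in>UNIV. Q_policy P R \<gamma> \<pi> $ i)" for \<pi>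
  obtain \<pi> where \<pi>: "total \<pi> = Max (range total)"
    by (rule Max_image_attained[of UNIV total]) (auto dest: sym)
  have best: "total \<pi>' \<le> total \<pi>" for \<pi>' by (simp add: \<pi>)
  define q where "q = Q_policy P R \<gamma> \<pi>"
  obtain \<pi>' where "\<And>s. q $ (s, \<pi>' s) = Max (range (\<lambda>a. q $ (s, a)))"
    by (rule greedy_policy[of q]) blast
  then have F: "bellman P R \<gamma> q = R + A_mat P \<gamma> \<pi>' *v q" by (rule bellman_greedy)
  define q' where "q' = Q_policy P R \<gamma> \<pi>'"
  have q_le_F: "q $ i \<le> bellman P R \<gamma> q $ i" for i
    using policy_le_bellman[OF P \<gamma>(1)] Q_policy_fixed_point[OF P \<gamma>] by (metis q_def)
  have le: "q $ i \<le> q' $ i" for i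
    unfolding q'_def using q_le_F F by (intro le_Q_policy[OF P \<gamma>]) simp
  \<comment> \<open>The greedy policy is at least as good in every entry but not better in total, so
    no entry can differ.\<close>
  have "(\<Sum>i\<in>UNIV. q' $ i) \<le> (\<Sum>i\<in>UNIV. q $ i)"
    using best[of \<pi>'] by (simp add: total_def q_def q'_def)
  then have "(\<Sum>i\<in>UNIV. q' $ i - q $ i) = 0"
    using sum_mono[of UNIV "\<lambda>i. q $ i" "\<lambda>i. q' $ i"] le by (simp add: sum_subtractf)
  then have "q' = q"
    using le by (subst (asm) sum_nonneg_eq_0_iff) (auto simp: vec_eq_iff)
  then have fixed: "bellman P R \<gamma> q = q"
    using F Q_policy_fixed_point[OF P \<gamma>, of R \<pi>'] by (simp add: q'_def)
  \<comment> \<open>Being fixed by the Bellman operator, \<open>q\<close> dominates its image under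
    the evaluation step of every policy, and hence the value of that policy. A single policy thus
    attains all the entrywise maxima in \<open>Q_star\<close>.\<close>
  have q_max: "Q_policy P R \<gamma> \<tau> $ i \<le> q $ i" for \<tau> i
    using policy_le_bellman[OF P \<gamma>(1), of R \<tau> q] by (intro Q_policy_le[OF P \<gamma>]) (simp add: fixed)
  have "Max (range (\<lambda>\<tau>. Q_policy P R \<gamma> \<tau> $ i)) = q $ i" for i
  proof (rule Max_eqI)
    show "q $ i \<in> range (\<lambda>\<tau>. Q_policy P R \<gamma> \<tau> $ i)" by (simp add: q_def)
  qed (auto intro: q_max)
  then have "Q_star P R \<gamma> = q" by (simp add: Q_star_def vec_eq_iff)
  then show ?thesis using fixed by simp
qed

section \<open>The error as a convex combination of matrix products\<close>

text \<open>Actions are selected independently in each state, so the hull is a product of intervals.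
  The proof separates \<open>w\<close> from the hull by a hyperplane and builds a selection on the
  wrong side of it.\<close>

lemma mem_convex_hull_selections:
  fixes w :: "real^'s" and e :: "real^('s::finite \<times> 'a::finite)"
  assumes "\<And>s. \<exists>a. e $ (s, a) \<le> w $ s" and "\<And>s. \<exists>a. w $ s \<le> e $ (s, a)"
  shows "w \<in> convex hull range (\<lambda>\<pi>. policy_matrix (one_hot \<pi>) *v e)" (is "_ \<in> ?H")
proof (rule ccontr)
  assume "w \<notin> ?H"
  moreover have "closed ?H"
    by (intro compact_imp_closed finite_imp_compact_convex_hull) simp
  ultimately obtain z b where z: "z \<bullet> w < b" "\<And>x. x \<in> ?H \<Longrightarrow> b < z \<bullet> x"
    using separating_hyperplane_closed_point[of ?H w] by auto
  \<comment> \<open>The sign of \<open>z $ s\<close> decides whether an entry of \<open>e\<close>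
    below or above \<open>w $ s\<close> is chosen.\<close>
  have "\<exists>a. z $ s * e $ (s, a) \<le> z $ s * w $ s" for s
  proof (cases "0 \<le> z $ s")
    case True
    then show ?thesis using assms(1) by (meson mult_left_mono)
  next
    case False
    then show ?thesis using assms(2) by (meson mult_left_mono_neg linear)
  qed
  then obtain \<pi> where \<pi>: "\<And>s. z $ s * e $ (s, \<pi> s) \<le> z $ s * w $ s" by metis
  have "b < z \<bullet> (policy_matrix (one_hot \<pi>) *v e)" by (intro z hull_inc) auto
  also have "\<dots> \<le> z \<bullet> w"
    unfolding inner_vec_def using \<pi> by (intro sum_mono) (simp add: policy_matrix_one_hot_mult)
  finally show False using z by simp
qed

text \<open>The rewards cancel, leaving \<open>\<gamma> *\<^sub>R P\<close> applied to the
  difference of the statewise maxima; a linear map carries the hull of selections to the hull of the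
  images.\<close>

lemma bellman_diff_mem_convex_hull:
  fixes Q Q' :: "real^('s::finite \<times> 'a::finite)"
  shows "bellman P R \<gamma> Q - bellman P R \<gamma> Q' \<in> convex hull range (\<lambda>\<pi>. A_mat P \<gamma> \<pi> *v (Q - Q'))"
proof -
  define V :: "real^('s \<times> 'a) \<Rightarrow> real^'s" where "V x = (\<chi> s. Max (range (\<lambda>a. x $ (s, a))))" for x
  obtain \<pi> where \<pi>: "\<And>s. Q $ (s, \<pi> s) = Max (range (\<lambda>a. Q $ (s, a)))"
    by (rule greedy_policy[of Q]) blast
  obtain \<pi>' where \<pi>': "\<And>s. Q' $ (s, \<pi>' s) = Max (range (\<lambda>a. Q' $ (s, a)))"
    by (rule greedy_policy[of Q']) blast
  have ge: "x $ (s, a) \<le> V x $ s" for x s a by (simp add: V_def)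
  \<comment> \<open>The greedy action of \<open>Q'\<close> gives the lower end of the bracket, that
    of \<open>Q\<close> the upper end.\<close>
  have "(Q - Q') $ (s, \<pi>' s) \<le> (V Q - V Q') $ s" for s
    using ge[of Q s "\<pi>' s"] by (simp add: V_def \<pi>')
  moreover have "(V Q - V Q') $ s \<le> (Q - Q') $ (s, \<pi> s)" for s
    using ge[of Q' s "\<pi> s"] by (simp add: V_def \<pi>)
  ultimately have "V Q - V Q' \<in> convex hull range (\<lambda>\<pi>. policy_matrix (one_hot \<pi>) *v (Q - Q'))"
    by (intro mem_convex_hull_selections) blast+
  then have "(\<gamma> *\<^sub>R P) *v (V Q - V Q')
      \<in> (*v) (\<gamma> *\<^sub>R P) ` (convex hull range (\<lambda>\<pi>. policy_matrix (one_hot \<pi>) *v (Q - Q')))"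
    by (rule imageI)
  also have "\<dots> = convex hull ((*v) (\<gamma> *\<^sub>R P) ` range (\<lambda>\<pi>. policy_matrix (one_hot \<pi>) *v (Q - Q')))"
    by (rule convex_hull_linear_image) simp
  also have "\<dots> = convex hull range (\<lambda>\<pi>. A_mat P \<gamma> \<pi> *v (Q - Q'))"
    by (simp add: image_image A_mat_def matrix_vector_mul_assoc
        scaleR_matrix_vector_assoc[symmetric])
  also have "(\<gamma> *\<^sub>R P) *v (V Q - V Q') = bellman P R \<gamma> Q - bellman P R \<gamma> Q'"
    by (simp add: vec_eq_iff bellman_def V_def matrix_vector_mult_def right_diff_distrib
        sum_subtractf sum_distrib_left mult.assoc)
  finally show ?thesis .
qed

section \<open>Projection away from the constant vectors and distance to \<open>X1\<close>\<close>

lemma proj_perp_mult: "proj_perp *v x = x - vec ((\<Sum>j\<in>UNIV. x $ j) / CARD('n))"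
  for x :: "real^'n"
  by (simp add: proj_perp_def vec_eq_iff matrix_vector_mult_diff_rdistrib
      scaleR_matrix_vector_assoc[symmetric]) (simp add: matrix_vector_mult_def)

lemma proj_perp_vec: "proj_perp *v vec t = (0 :: real^'n)"
  by (simp add: proj_perp_mult vec_eq_iff)

lemma proj_perp_idem: "proj_perp *v (proj_perp *v x) = proj_perp *v (x :: real^'n)"
  by (subst (2) proj_perp_mult)
    (simp add: matrix_vector_mult_diff_distrib proj_perp_vec)

text \<open>The projected vector has entry sum 0 and is orthogonal to all constant vectors, while
  \<open>x - vec t\<close> differs from it by a constant vector; Pythagoras applies.\<close>

lemma norm_proj_perp_le: "norm (proj_perp *v x) \<le> norm (x - vec t)" for x :: "real^'n"
proof -
  define y where "y = proj_perp *v x"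
  define u where "u = (\<Sum>j\<in>UNIV. x $ j) / CARD('n) - t"
  have split: "x - vec t = y + vec u"
    by (simp add: y_def u_def proj_perp_mult vec_eq_iff)
  have "y \<bullet> vec u = u * (\<Sum>j\<in>UNIV. y $ j)"
    by (simp add: inner_vec_def sum_distrib_left mult.commute)
  also have "(\<Sum>j\<in>UNIV. y $ j) = 0"
    by (simp add: y_def proj_perp_mult sum_subtractf)
  finally have "norm (x - vec t) ^ 2 = norm y ^ 2 + norm (vec u :: real^'n) ^ 2"
    unfolding split by (intro norm_add_Pythagorean) (simp add: orthogonal_def)
  then have "norm y ^ 2 \<le> norm (x - vec t) ^ 2" by simp
  then show ?thesis unfolding y_def by (rule power2_le_imp_le) simp
qed

text \<open>The nearest point is \<open>Q_star\<close> shifted by the mean of the error; no other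
  shift does better by \<open>norm_proj_perp_le\<close>.\<close>

lemma infdist_X1:
  "infdist Q (X1 P R \<gamma>) = norm (proj_perp *v (Q - Q_star P R \<gamma>))" (is "_ = norm (_ *v ?e)")
proof -
  have X1: "X1 P R \<gamma> = range (\<lambda>t. Q_star P R \<gamma> + vec t)"
  proof -
    have "t *\<^sub>R vec 1 = (vec t :: real^('a \<times> 'b))" for t by (simp add: vec_eq_iff)
    then show ?thesis by (simp add: X1_def span_singleton image_image)
  qed
  have dist: "dist Q (Q_star P R \<gamma> + vec t) = norm (?e - vec t)" for t
    by (simp add: dist_norm algebra_simps)
  show ?thesis
  proof (rule antisym)
    show "infdist Q (X1 P R \<gamma>) \<le> norm (proj_perp *v ?e)"
      unfolding proj_perp_mult dist[symmetric] by (rule infdist_le) (simp add: X1)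
    show "norm (proj_perp *v ?e) \<le> infdist Q (X1 P R \<gamma>)"
      unfolding X1 infdist_def using dist norm_proj_perp_le[of ?e]
      by (auto intro!: cINF_greatest)
  qed
qed

text \<open>The rows of \<open>P\<close> sum to 1, so \<open>A_mat\<close> sends constant vectors to
  constant vectors. Dropping the constant part of \<open>x\<close> beforehand therefore changes the
  image by a constant, which the outer projection removes.\<close>

lemma A_bar_proj_perp:
  assumes P: "transition_matrix P"
  shows "A_bar P \<gamma> \<pi> *v (proj_perp *v x) = proj_perp *v (A_mat P \<gamma> \<pi> *v x)"
proof -
  define t where "t = (\<Sum>j\<in>UNIV. x $ j) / CARD('a \<times> 'b)"
  have x: "x = proj_perp *v x + vec t" by (simp add: proj_perp_mult t_def)
  have "A_mat P \<gamma> \<pi> *v vec t = vec (\<gamma> * t)"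
    using P by (auto simp: vec_eq_iff A_mat_mult sum_distrib_right[symmetric] transition_matrix_def)
  then have "proj_perp *v (A_mat P \<gamma> \<pi> *v x) = proj_perp *v (A_mat P \<gamma> \<pi> *v (proj_perp *v x))"
    by (subst x) (simp add: matrix_vector_right_distrib proj_perp_vec)
  then show ?thesis
    by (simp add: A_bar_def matrix_vector_mul_assoc[symmetric] proj_perp_idem)
qed

lemma iterate_mem_convex_hull:
  assumes P: "transition_matrix P" and \<gamma>: "0 < \<gamma>" "\<gamma> < 1"
  shows "proj_perp *v ((bellman P R \<gamma> ^^ k) Q0 - Q_star P R \<gamma>)
    \<in> convex hull ((\<lambda>Ms. matrix_list_prod Ms *v (proj_perp *v (Q0 - Q_star P R \<gamma>))) `
        {Ms. length Ms = k \<and> set Ms \<subseteq> range (A_bar P \<gamma>)})"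
    (is "?e k \<in> convex hull ?S k")
proof (induction k)
  case 0
  have "?S 0 = {?e 0}"
    by (auto simp: matrix_list_prod_def)
  then show ?case by simp
next
  case (Suc k)
  let ?d = "(bellman P R \<gamma> ^^ k) Q0 - Q_star P R \<gamma>"
  have step: "A_bar P \<gamma> \<pi> *v ?e k \<in> convex hull ?S (Suc k)" for \<pi>
  proof -
    have "A_bar P \<gamma> \<pi> *v ?e k \<in> (*v) (A_bar P \<gamma> \<pi>) ` (convex hull ?S k)"
      using Suc by (rule imageI)
    also have "\<dots> = convex hull ((*v) (A_bar P \<gamma> \<pi>) ` ?S k)"
      by (rule convex_hull_linear_image) simp
    also have "\<dots> \<subseteq> convex hull ?S (Suc k)"
    proof (rule hull_mono, safe)
      fix Ms :: "(real^('a \<times> 'b)^('a \<times> 'b)) list"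
      assume "set Ms \<subseteq> range (A_bar P \<gamma>)" and "k = length Ms"
      then show "A_bar P \<gamma> \<pi> *v (matrix_list_prod Ms *v (proj_perp *v (Q0 - Q_star P R \<gamma>)))
          \<in> ?S (Suc (length Ms))"
        \<comment> \<open>The new matrix goes to the end of the list because the last entry acts
          last.\<close>
        by (intro image_eqI[of _ _ "Ms @ [A_bar P \<gamma> \<pi>]"])
          (auto simp: matrix_list_prod_snoc matrix_vector_mul_assoc matrix_mul_assoc)
    qed
    finally show ?thesis .
  qed
  have "(bellman P R \<gamma> ^^ Suc k) Q0 - Q_star P R \<gamma> \<in> convex hull range (\<lambda>\<pi>. A_mat P \<gamma> \<pi> *v ?d)"
    \<comment> \<open>Since \<open>Q_star\<close> is a fixed point, the new error is a difference of
      two Bellman images.\<close>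
    using bellman_diff_mem_convex_hull[of P R \<gamma> "(bellman P R \<gamma> ^^ k) Q0" "Q_star P R \<gamma>"]
    by (simp add: bellman_Q_star[OF P \<gamma>])
  then have "?e (Suc k) \<in> (*v) proj_perp ` (convex hull range (\<lambda>\<pi>. A_mat P \<gamma> \<pi> *v ?d))"
    by (rule imageI)
  also have "\<dots> = convex hull ((*v) proj_perp ` range (\<lambda>\<pi>. A_mat P \<gamma> \<pi> *v ?d))"
    by (rule convex_hull_linear_image) simp
  also have "\<dots> = convex hull range (\<lambda>\<pi>. A_bar P \<gamma> \<pi> *v ?e k)"
    by (simp add: image_image A_bar_proj_perp[OF P])
  also have "\<dots> \<subseteq> convex hull ?S (Suc k)"
    using step by (intro hull_minimal) auto
  finally show ?case .
qed

theorem theorem1: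
  fixes P :: "real^'s^('s::finite \<times> 'a::finite)"
    and R :: "real^('s \<times> 'a)"
    and \<gamma> \<epsilon> \<beta> :: real
  assumes "transition_matrix P"
    and "0 < \<gamma>" and "\<gamma> < 1"
    and "0 < \<epsilon>"
    and "\<beta> = joint_spectral_radius (range (A_bar P \<gamma>)) + \<epsilon>"
    and "0 < \<beta>" and "\<beta> < 1"
  shows "\<exists>c>0. \<forall>Q0 :: real^('s \<times> 'a). \<forall>k :: nat.
           infdist ((bellman P R \<gamma> ^^ k) Q0) (X1 P R \<gamma>) \<le> c * \<beta> ^ k * infdist Q0 (X1 P R \<gamma>)"
proof -
  have "joint_spectral_radius (range (A_bar P \<gamma>)) < \<beta>" using assms by simp
  \<comment> \<open>The constant is fixed here, before \<open>Q0\<close> and \<open>k\<close>, and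
    depends only on the matrix family and \<open>\<beta>\<close>.\<close>
  then obtain c where c: "0 < c" and bound: "\<And>Ms. set Ms \<subseteq> range (A_bar P \<gamma>) \<Longrightarrow>
      onorm ((*v) (matrix_list_prod Ms)) \<le> c * \<beta> ^ length Ms"
    using joint_spectral_radius_bound[of "range (A_bar P \<gamma>)" \<beta>] \<open>0 < \<beta>\<close>
    by (metis UNIV_not_empty finite finite_imageI image_is_empty)
  have "infdist ((bellman P R \<gamma> ^^ k) Q0) (X1 P R \<gamma>) \<le> c * \<beta> ^ k * infdist Q0 (X1 P R \<gamma>)" for Q0 k
  proof -
    let ?x = "proj_perp *v (Q0 - Q_star P R \<gamma>)"
    have "norm (matrix_list_prod Ms *v ?x) \<le> c * \<beta> ^ length Ms * norm ?x"
      if "set Ms \<subseteq> range (A_bar P \<gamma>)" for Ms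
    proof -
      have "norm (matrix_list_prod Ms *v ?x) \<le> onorm ((*v) (matrix_list_prod Ms)) * norm ?x"
        by (rule onorm) simp
      also have "\<dots> \<le> c * \<beta> ^ length Ms * norm ?x"
        using bound[OF that] by (rule mult_right_mono) simp
      finally show ?thesis .
    qed
    \<comment> \<open>A ball is convex, so the bound for single products passes to all their convex
      combinations.\<close>
    then have "convex hull ((\<lambda>Ms. matrix_list_prod Ms *v ?x) `
        {Ms. length Ms = k \<and> set Ms \<subseteq> range (A_bar P \<gamma>)}) \<subseteq> cball 0 (c * \<beta> ^ k * norm ?x)"
      by (intro hull_minimal) auto
    then show ?thesis
      using iterate_mem_convex_hull[OF assms(1-3), of k R Q0] by (auto simp: infdist_X1)
  qed
  then show ?thesis using c by blast
qed

end
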